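(* Fix $\sigma>0$ and $t_1,t_2>0$ with $t_1\neq t_2$. For $x_0,\mu\in\mathbb{R}$ and $i\in\{1,2\}$ let $\gamma_{(x_0,\mu,t_i)}$ denote the Gaussian probability measure on $\mathbb{R}$ with mean $x_0+\mu t_i$ and variance $\sigma^2 t_i$, and put $\gamma_{(x_0,\mu)}=\gamma_{(x_0,\mu,t_1)}\times\gamma_{(x_0,\mu,t_2)}$, a probability measure on $\mathbb{R}^2$. For $n\in\mathbb{N}$ let $\mathbf{T}_n:(\mathbb{R}^2)^n\to\mathbb{R}^2$ be given by $$\mathbf{T}_n\big((z^{(1)}_k,z^{(2)}_k)_{1\le k\le n}\big)=\left(\frac{\sum_{k=1}^n\big(t_2z^{(1)}_k-t_1z^{(2)}_k\big)}{n(t_2-t_1)},\ \frac{\sum_{k=1}^n\big(z^{(2)}_k-z^{(1)}_k\big)}{n(t_2-t_1)}\right).$$ Then the estimators $\mathbf{T}^{(0)}:(\mathbb{R}^2)^\infty\to\mathbb{R}^2$ and $\mathbf{T}^{(1)}:(\mathbb{R}^2)^\infty\to\mathbb{R}^2$ defined by $$\mathbf{T}^{(0)}\big((z^{(1)}_k,z^{(2)}_k)_{k\in\mathbb{N}}\big)=\liminf_{n\to\infty}\mathbf{T}_n\big((z^{(1)}_k,z^{(2)}_k)_{1\le k\le n}\big)$$ and $$\mathbf{T}^{(1)}\big((z^{(1)}_k,z^{(2)}_k)_{k\in\mathbb{N}}\big)=\limsup_{n\to\infty}\mathbf{T}_n\big((z^{(1)}_k,z^{(2)}_k)_{1\le k\le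 n}\big)$$ (lower and upper limits taken componentwise) are infinite-sample consistent estimators of the parameter $(x_0,\mu)$ for the family of probability measures $(\gamma_{(x_0,\mu)}^\infty)_{(x_0,\mu)\in\mathbb{R}^2}$.
   Context: $\mathbb{N}=\{1,2,\dots\}$, and $(\mathbb{R}^2)^{\infty}=(\mathbb{R}^2)^{\mathbb{N}}$ is the space of sequences in $\mathbb{R}^2$ with its Borel $\sigma$-algebra. For a Borel probability measure $\gamma$ on $\mathbb{R}^2$, $\gamma^{\infty}$ is the infinite product (power) measure on $(\mathbb{R}^2)^{\infty}$. The measure $\gamma_{(x_0,\mu,t_i)}$ is the law at time $t_i$ of the Wiener process with drift $X_t=x_0+\mu t+\sigma W_t$. Given a family $(\gamma_\theta)_{\theta\in\mathbb{R}^2}$ of Borel probability measures on $\mathbb{R}^2$, a Borel measurable function $\mathbf{T}:(\mathbb{R}^2)^\infty\to\mathbb{R}^2$ is called an infinite-sample consistent estimator of the parameter $\theta$ for the family $(\gamma_\theta^\infty)_{\theta\in\mathbb{R}^2}$ if $\gamma_\theta^\infty(\{(x_k)_{k\in\mathbb{N}}\in(\mathbb{R}^2)^\infty:\mathbf{T}((x_k)_{k\in\mathbb{N}})=\theta\})=1$ for every $\theta\in\mathbb{R}^2$. *)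

theory Defs
  imports "HOL-Probability.Probability"
begin

definition gaussian_measure :: "real \<Rightarrow> real \<Rightarrow> real measure" where
  "gaussian_measure m v = density lborel (\<lambda>x. ennreal (normal_density m (sqrt v) x))"
  (* v is the variance, whereas normal_density expects the standard deviation. *)

definition drift_wiener_law :: "real \<Rightarrow> real \<Rightarrow> real \<Rightarrow> real \<Rightarrow> real measure" where
  "drift_wiener_law \<sigma> x0 \<mu> t = gaussian_measure (x0 + \<mu> * t) (\<sigma>\<^sup>2 * t)"

definition two_time_law ::
    "real \<Rightarrow> real \<Rightarrow> real \<Rightarrow> real \<times> real \<Rightarrow> (real \<times> real) measure" where
  "two_time_law \<sigma> t1 t2 = (\<lambda>(x0, \<mu>).
     drift_wiener_law \<sigma> x0 \<mu> t1 \<Otimes>\<^sub>M drift_wiener_law \<sigma> x0 \<mu> t2)"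

(* Sequences (x_1, x_2, ...) are indexed from 0 here: x_k is x (k - 1).
   The Borel sets of nat => real * real are those of the product topology. *)

definition power_measure :: "(real \<times> real) measure \<Rightarrow> (nat \<Rightarrow> real \<times> real) measure" where
  "power_measure \<gamma> = PiM UNIV (\<lambda>_. \<gamma>)"

definition infinite_sample_consistent_estimator ::
    "(real \<times> real \<Rightarrow> (real \<times> real) measure) \<Rightarrow>
     ((nat \<Rightarrow> real \<times> real) \<Rightarrow> real \<times> real) \<Rightarrow> bool" where
  "infinite_sample_consistent_estimator \<gamma> T \<longleftrightarrow>
     (\<forall>\<theta>. prob_space (\<gamma> \<theta>) \<and> sets (\<gamma> \<theta>) = sets borel) \<and>
     T \<in> borel_measurable borel \<and>
     (\<forall>\<theta>. emeasure (power_measure (\<gamma> \<theta>)) {x. T x = \<theta>} = 1)"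

(* The n-sample estimator; it depends only on the first n entries of z. *)
definition T_n :: "real \<Rightarrow> real \<Rightarrow> nat \<Rightarrow> (nat \<Rightarrow> real \<times> real) \<Rightarrow> real \<times> real" where
  "T_n t1 t2 n z =
     ((\<Sum>k<n. t2 * fst (z k) - t1 * snd (z k)) / (real n * (t2 - t1)),
      (\<Sum>k<n. snd (z k) - fst (z k)) / (real n * (t2 - t1)))"

(* The lower and upper limits are taken in the extended reals. real_of_ereal makes the
   estimators real-valued: a component whose limit is infinite gets the value 0. *)

definition T_lower :: "real \<Rightarrow> real \<Rightarrow> (nat \<Rightarrow> real \<times> real) \<Rightarrow> real \<times> real" where
  "T_lower t1 t2 z =
     (real_of_ereal (liminf (\<lambda>n. ereal (fst (T_n t1 t2 n z)))),
      real_of_ereal (liminf (\<lambda>n. ereal (snd (T_n t1 t2 n z)))))"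

definition T_upper :: "real \<Rightarrow> real \<Rightarrow> (nat \<Rightarrow> real \<times> real) \<Rightarrow> real \<times> real" where
  "T_upper t1 t2 z =
     (real_of_ereal (limsup (\<lambda>n. ereal (fst (T_n t1 t2 n z)))),
      real_of_ereal (limsup (\<lambda>n. ereal (snd (T_n t1 t2 n z)))))"

end

theory Submission
  imports Defs
begin

text \<open>The sample means of independent identically distributed normal variables are again normal,
  with fourth central moments of order \<open>1 / n\<^sup>2\<close>. These are summable, so the fourth powers of the
  deviations are almost surely summable and the means converge almost surely. The estimator
  \<open>T_n\<close> is a linear image of the two coordinate means \<open>(A\<^sub>n, B\<^sub>n)\<close>, namely the inverse of
  \<open>(x0, \<mu>) \<mapsto> (x0 + \<mu> t1, x0 + \<mu> t2)\<close>, so it converges almost surely to \<open>(x0, \<mu>)\<close>.\<close>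

text \<open>Since the terms are nonnegative, sum and integral may be exchanged, so the series of the
  \<open>D n\<close> has finite expectation. It is therefore finite almost everywhere, and the terms
  of a convergent series tend to zero.\<close>

lemma (in prob_space) AE_tendsto_zero_if_summable_expectation:
  fixes D :: "nat \<Rightarrow> 'a \<Rightarrow> real"
  assumes D: "\<And>n. integrable M (D n)" and nonneg: "\<And>n x. 0 \<le> D n x"
    and summable: "summable (\<lambda>n. expectation (D n))"
  shows "AE x in M. (\<lambda>n. D n x) \<longlonglongrightarrow> 0"
proof -
  have [measurable]: "D n \<in> borel_measurable M" for n
    using D by auto
  have "(\<integral>\<^sup>+x. (\<Sum>n. ennreal (D n x)) \<partial>M) = (\<Sum>n. \<integral>\<^sup>+x. ennreal (D n x) \<partial>M)"
    by (intro nn_integral_suminf) auto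
  also have "\<dots> = (\<Sum>n. ennreal (expectation (D n)))"
    by (intro suminf_cong nn_integral_eq_integral D AE_I2 nonneg)
  also have "\<dots> = ennreal (\<Sum>n. expectation (D n))"
    using summable by (intro suminf_ennreal2) (auto intro: integral_nonneg_AE simp: nonneg)
  finally have "AE x in M. (\<Sum>n. ennreal (D n x)) \<noteq> \<infinity>"
    by (intro nn_integral_noteq_infinite) auto
  then show ?thesis
    by eventually_elim
      (auto intro!: summable_LIMSEQ_zero summable_suminf_not_top simp: nonneg)
qed

text \<open>Second moments would not do: the variance of the n-th mean is
  \<open>s\<^sup>2 / n\<close>, which is not summable. Normality of the means gives their fourth
  moments in closed form, without expanding the fourth power of a sum.\<close>

lemma (in prob_space) normal_strong_law_of_large_numbers:
  fixes X :: "nat \<Rightarrow> 'a \<Rightarrow> real"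
  assumes indep: "indep_vars (\<lambda>_. borel) X UNIV" and s: "0 < s"
    and X: "\<And>k. distributed M lborel (X k) (normal_density m s)"
  shows "AE x in M. (\<lambda>n. (\<Sum>k<n. X k x) / real n) \<longlonglongrightarrow> m"
proof -
  \<comment> \<open>The shift to \<open>Suc n\<close> leaves out the empty mean, which is constant
    and has no density. \<open>LIMSEQ_imp_Suc\<close> undoes the shift at the end.\<close>
  define Y where "Y n x = (\<Sum>k<Suc n. X k x) / real (Suc n)" for n x
  define \<tau> where "\<tau> n = s / sqrt (real (Suc n))" for n
  have \<tau>: "0 < \<tau> n" for n
    using s by (simp add: \<tau>_def)
  have Y: "distributed M lborel (Y n) (normal_density m (\<tau> n))" for n
  proof -
    have "distributed M lborel (\<lambda>x. \<Sum>k<Suc n. X k x)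
        (normal_density (\<Sum>k<Suc n. m) (sqrt (\<Sum>k<Suc n. s\<^sup>2)))"
      by (intro sum_indep_normal X s indep_vars_subset[OF indep]) auto
    from normal_density_affine[OF this, of "1 / real (Suc n)" 0]
    have "distributed M lborel (Y n) (normal_density (real (Suc n) * m / real (Suc n))
        (sqrt (real (Suc n) * s\<^sup>2) / real (Suc n)))"
      using s by (simp add: Y_def [abs_def] del: of_nat_Suc sum.lessThan_Suc)
    moreover have "sqrt (real (Suc n) * s\<^sup>2) / real (Suc n) = \<tau> n"
      using s real_div_sqrt[of "real (Suc n)"]
      by (simp add: \<tau>_def real_sqrt_mult field_simps del: of_nat_Suc)
    ultimately show ?thesis
      by simp
  qed
  have moment: "has_bochner_integral lborel (\<lambda>y. normal_density m (\<tau> n) y * (y - m) ^ 4)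
      (3 * s ^ 4 * inverse ((real (Suc n))\<^sup>2))" for n
  proof -
    \<comment> \<open>The left side is the constant of \<open>normal_moment_even\<close> for the
      central moment of order 2 * 2.\<close>
    have "fact (2 * 2) / ((2 / (\<tau> n)\<^sup>2) ^ 2 * fact 2) = 3 * (\<tau> n) ^ 4"
      using \<tau>[of n] by (simp add: fact_numeral field_simps flip: power_mult)
    also have "(\<tau> n) ^ 4 = ((\<tau> n)\<^sup>2)\<^sup>2"
      by (simp flip: power_mult)
    also have "\<dots> = s ^ 4 * inverse ((real (Suc n))\<^sup>2)"
      by (simp add: \<tau>_def power_divide flip: power_mult divide_inverse)
    finally show ?thesis
      using normal_moment_even[OF \<tau>[of n], of m 2] by (simp add: mult.assoc)
  qed
  have integrable: "integrable M (\<lambda>x. (Y n x - m) ^ 4)" for n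
    using distributed_integrable[OF Y[of n], of "\<lambda>y. (y - m) ^ 4"] moment[of n]
    by (auto simp: has_bochner_integral_iff)
  have expectation: "expectation (\<lambda>x. (Y n x - m) ^ 4) = 3 * s ^ 4 * inverse ((real (Suc n))\<^sup>2)"
    for n
    using distributed_integral[OF Y[of n], of "\<lambda>y. (y - m) ^ 4"] moment[of n]
    by (auto simp: has_bochner_integral_iff)
  have "summable (\<lambda>n. inverse ((real (Suc n))\<^sup>2))"
    using inverse_power_summable[of 2, where 'a=real] by (subst summable_Suc_iff) simp
  then have "AE x in M. (\<lambda>n. (Y n x - m) ^ 4) \<longlonglongrightarrow> 0"
    by (intro AE_tendsto_zero_if_summable_expectation integrable)
      (auto simp: expectation intro: summable_mult simp del: of_nat_Suc)
  then show ?thesis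
  proof eventually_elim
    case (elim x)
    then have "(\<lambda>n. Y n x - m) \<longlonglongrightarrow> 0"
      by simp
    then have "(\<lambda>n. Y n x) \<longlonglongrightarrow> m"
      by (simp add: LIM_zero_iff)
    then show ?case
      unfolding Y_def by (rule LIMSEQ_imp_Suc)
  qed
qed

text \<open>Mirror image of \<open>distr_pair_fst\<close>: the preimage of \<open>A\<close> is the
  rectangle \<open>space M \<times> A\<close>, whose first side has mass one.\<close>

lemma distr_pair_measure_snd:
  assumes "prob_space M" "sigma_finite_measure N"
  shows "distr (M \<Otimes>\<^sub>M N) N snd = N"
proof (rule measure_eqI)
  interpret M: prob_space M by fact
  interpret N: sigma_finite_measure N by fact
  fix A assume "A \<in> sets (distr (M \<Otimes>\<^sub>M N) N snd)"
  then have A: "A \<in> sets N" by simp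
  have "emeasure (distr (M \<Otimes>\<^sub>M N) N snd) A = emeasure (M \<Otimes>\<^sub>M N) (space M \<times> A)"
    using A by (subst emeasure_distr)
      (auto simp: space_pair_measure dest: sets.sets_into_space intro!: arg_cong2[where f=emeasure])
  then show "emeasure (distr (M \<Otimes>\<^sub>M N) N snd) A = emeasure N A"
    using A by (simp add: N.emeasure_pair_measure_Times M.emeasure_space_1)
qed simp

text \<open>Independence says that the joint law is the product of the marginals. Here the joint map
  is the identity and every marginal is \<open>\<gamma>\<close>, so both sides are the same product
  measure.\<close>

lemma indep_vars_PiM_coordinates:
  assumes "prob_space \<gamma>"
  shows "prob_space.indep_vars (PiM UNIV (\<lambda>_. \<gamma>)) (\<lambda>_. \<gamma>) (\<lambda>k z. z k) UNIV"
proof -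
  interpret P: prob_space "PiM UNIV (\<lambda>_. \<gamma>)"
    by (intro prob_space_PiM assms)
  show ?thesis
    by (subst P.indep_vars_iff_distr_eq_PiM')
      (simp_all add: distr_PiM_component[OF assms] restrict_UNIV distr_id2)
qed

lemma PiM_normal_strong_law_of_large_numbers:
  fixes f :: "'a \<Rightarrow> real"
  assumes \<gamma>: "prob_space \<gamma>" and f: "distributed \<gamma> lborel f (normal_density m s)" and s: "0 < s"
  shows "AE z in PiM UNIV (\<lambda>_. \<gamma>). (\<lambda>n. (\<Sum>k<n. f (z k)) / real n) \<longlonglongrightarrow> m"
proof -
  interpret P: prob_space "PiM UNIV (\<lambda>_::nat. \<gamma>)"
    by (intro prob_space_PiM \<gamma>)
  have f_meas [measurable]: "f \<in> borel_measurable \<gamma>"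
    using distributed_measurable[OF f] by simp
  show ?thesis
  proof (rule P.normal_strong_law_of_large_numbers[OF _ s])
    show "P.indep_vars (\<lambda>_. borel) (\<lambda>k z. f (z k)) UNIV"
      by (rule P.indep_vars_compose2[OF indep_vars_PiM_coordinates[OF \<gamma>]]) simp
    fix k :: nat
    \<comment> \<open>Factoring through the k-th coordinate, whose law is \<open>\<gamma>\<close>,
      reduces the law of \<open>f (z k)\<close> to that of \<open>f\<close> under
      \<open>\<gamma>\<close>.\<close>
    have "distr (PiM UNIV (\<lambda>_::nat. \<gamma>)) lborel (\<lambda>z. f (z k))
        = distr (distr (PiM UNIV (\<lambda>_::nat. \<gamma>)) \<gamma> (\<lambda>z. z k)) lborel f"
      by (subst distr_distr) (auto simp: comp_def)
    also have "\<dots> = density lborel (normal_density m s)"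
      using f by (simp add: distr_PiM_component[OF \<gamma>] distributed_def)
    finally show "distributed (PiM UNIV (\<lambda>_. \<gamma>)) lborel (\<lambda>z. f (z k)) (normal_density m s)"
      by (auto simp: distributed_def)
  qed
qed

lemma prob_space_drift_wiener_law:
  "0 < \<sigma> \<Longrightarrow> 0 < t \<Longrightarrow> prob_space (drift_wiener_law \<sigma> x0 \<mu> t)"
  unfolding drift_wiener_law_def gaussian_measure_def by (intro prob_space_normal_density) simp

lemma sets_drift_wiener_law [measurable_cong]: "sets (drift_wiener_law \<sigma> x0 \<mu> t) = sets borel"
  by (simp add: drift_wiener_law_def gaussian_measure_def)

lemma sets_two_time_law [measurable_cong]: "sets (two_time_law \<sigma> t1 t2 \<theta>) = sets borel"
  by (cases \<theta>)
    (simp add: two_time_law_def borel_prod[symmetric] sets_drift_wiener_law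
      sets_pair_measure_cong[OF sets_drift_wiener_law sets_drift_wiener_law])

lemma distributed_two_time_law:
  assumes "0 < \<sigma>" "0 < t1" "0 < t2"
  shows "distributed (two_time_law \<sigma> t1 t2 (x0, \<mu>)) lborel fst
      (normal_density (x0 + \<mu> * t1) (sqrt (\<sigma>\<^sup>2 * t1)))"
    and "distributed (two_time_law \<sigma> t1 t2 (x0, \<mu>)) lborel snd
      (normal_density (x0 + \<mu> * t2) (sqrt (\<sigma>\<^sup>2 * t2)))"
proof -
  let ?L = "drift_wiener_law \<sigma> x0 \<mu>"
  interpret L1: prob_space "?L t1" using assms by (intro prob_space_drift_wiener_law)
  interpret L2: prob_space "?L t2" using assms by (intro prob_space_drift_wiener_law)
  \<comment> \<open>\<open>distr\<close> uses only the measurable sets of its target. Both targets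
    carry the Borel sets, so \<open>lborel\<close> can be replaced by the factor that the marginal
    rule expects.\<close>
  have "distr (?L t1 \<Otimes>\<^sub>M ?L t2) lborel fst = distr (?L t1 \<Otimes>\<^sub>M ?L t2) (?L t1) fst"
    by (intro distr_cong) (auto simp: sets_drift_wiener_law)
  also have "\<dots> = ?L t1"
    by (rule L2.distr_pair_fst)
  finally show "distributed (two_time_law \<sigma> t1 t2 (x0, \<mu>)) lborel fst
      (normal_density (x0 + \<mu> * t1) (sqrt (\<sigma>\<^sup>2 * t1)))"
    by (simp add: distributed_def two_time_law_def)
      (simp add: drift_wiener_law_def gaussian_measure_def)
  have "distr (?L t1 \<Otimes>\<^sub>M ?L t2) lborel snd = distr (?L t1 \<Otimes>\<^sub>M ?L t2) (?L t2) snd"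
    by (intro distr_cong) (auto simp: sets_drift_wiener_law)
  also have "\<dots> = ?L t2"
    by (intro distr_pair_measure_snd L1.prob_space_axioms L2.sigma_finite_measure_axioms)
  finally show "distributed (two_time_law \<sigma> t1 t2 (x0, \<mu>)) lborel snd
      (normal_density (x0 + \<mu> * t2) (sqrt (\<sigma>\<^sup>2 * t2)))"
    by (simp add: distributed_def two_time_law_def)
      (simp add: drift_wiener_law_def gaussian_measure_def)
qed

lemma prob_space_two_time_law:
  assumes "0 < \<sigma>" "0 < t1" "0 < t2"
  shows "prob_space (two_time_law \<sigma> t1 t2 \<theta>)"
  using assms
  by (cases \<theta>) (auto simp: two_time_law_def intro!: prob_space_pair prob_space_drift_wiener_law)

text \<open>Reduces both convergence and measurability to the two coordinate means. The case
  \<open>n = 0\<close> is covered because division by zero yields zero.\<close>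

lemma T_n_eq_means:
  "fst (T_n t1 t2 n z) =
     (t2 * ((\<Sum>k<n. fst (z k)) / real n) - t1 * ((\<Sum>k<n. snd (z k)) / real n)) / (t2 - t1)"
  "snd (T_n t1 t2 n z) =
     ((\<Sum>k<n. snd (z k)) / real n - (\<Sum>k<n. fst (z k)) / real n) / (t2 - t1)"
  by (simp_all add: T_n_def sum_subtractf sum_distrib_left[symmetric] diff_divide_distrib)

lemma AE_T_n_tendsto:
  assumes "0 < \<sigma>" "0 < t1" "0 < t2" "t1 \<noteq> t2"
  shows "AE z in power_measure (two_time_law \<sigma> t1 t2 (x0, \<mu>)).
    (\<lambda>n. fst (T_n t1 t2 n z)) \<longlonglongrightarrow> x0 \<and> (\<lambda>n. snd (T_n t1 t2 n z)) \<longlonglongrightarrow> \<mu>"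
proof -
  note slln = PiM_normal_strong_law_of_large_numbers[OF prob_space_two_time_law[OF assms(1-3)]]
  have "AE z in power_measure (two_time_law \<sigma> t1 t2 (x0, \<mu>)).
      (\<lambda>n. (\<Sum>k<n. fst (z k)) / real n) \<longlonglongrightarrow> x0 + \<mu> * t1"
    unfolding power_measure_def
    using assms by (intro slln[OF distributed_two_time_law(1)]) auto
  moreover have "AE z in power_measure (two_time_law \<sigma> t1 t2 (x0, \<mu>)).
      (\<lambda>n. (\<Sum>k<n. snd (z k)) / real n) \<longlonglongrightarrow> x0 + \<mu> * t2"
    unfolding power_measure_def
    using assms by (intro slln[OF distributed_two_time_law(2)]) auto
  ultimately show ?thesis
  proof eventually_elim
    case (elim z)
    have "(\<lambda>n. fst (T_n t1 t2 n z)) \<longlonglongrightarrow>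
        (t2 * (x0 + \<mu> * t1) - t1 * (x0 + \<mu> * t2)) / (t2 - t1)"
      unfolding T_n_eq_means using assms by (intro tendsto_intros elim) auto
    moreover have "(\<lambda>n. snd (T_n t1 t2 n z)) \<longlonglongrightarrow>
        ((x0 + \<mu> * t2) - (x0 + \<mu> * t1)) / (t2 - t1)"
      unfolding T_n_eq_means using assms by (intro tendsto_intros elim) auto
    \<comment> \<open>Cramer's rule for the system \<open>a = x0 + \<mu> * t1\<close>,
      \<open>b = x0 + \<mu> * t2\<close>, whose determinant \<open>t2 - t1\<close> is
      nonzero.\<close>
    moreover have "(t2 * (x0 + \<mu> * t1) - t1 * (x0 + \<mu> * t2)) / (t2 - t1) = x0"
      "((x0 + \<mu> * t2) - (x0 + \<mu> * t1)) / (t2 - t1) = \<mu>"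
      using assms by (simp_all add: field_simps)
    ultimately show ?case by simp
  qed
qed

text \<open>A convergent sequence has equal lower and upper limits. As they are finite here,
  \<open>real_of_ereal\<close> returns the limit itself and not its default value 0.\<close>

lemma T_limits_eq:
  assumes "(\<lambda>n. fst (T_n t1 t2 n z)) \<longlonglongrightarrow> x0" "(\<lambda>n. snd (T_n t1 t2 n z)) \<longlonglongrightarrow> \<mu>"
  shows "T_lower t1 t2 z = (x0, \<mu>)" and "T_upper t1 t2 z = (x0, \<mu>)"
proof -
  have lim: "(\<lambda>n. ereal (fst (T_n t1 t2 n z))) \<longlonglongrightarrow> ereal x0"
    "(\<lambda>n. ereal (snd (T_n t1 t2 n z))) \<longlonglongrightarrow> ereal \<mu>"
    using assms by simp_all
  show "T_lower t1 t2 z = (x0, \<mu>)" "T_upper t1 t2 z = (x0, \<mu>)"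
    using lim[THEN lim_imp_Liminf[OF trivial_limit_sequentially]]
      lim[THEN lim_imp_Limsup[OF trivial_limit_sequentially]]
    by (simp_all add: T_lower_def T_upper_def)
qed

lemma T_limits_measurable:
  "T_lower t1 t2 \<in> borel_measurable borel" "T_upper t1 t2 \<in> borel_measurable borel"
proof -
  \<comment> \<open>The Borel sets of the sequence space come from the product topology, in which
    coordinate projections are continuous.\<close>
  have [measurable]: "(\<lambda>z :: nat \<Rightarrow> real \<times> real. z k) \<in> borel_measurable borel" for k
    by (intro borel_measurable_continuous_onI) simp
  have [measurable]: "(\<lambda>z :: nat \<Rightarrow> real \<times> real. fst (z k)) \<in> borel_measurable borel"
    "(\<lambda>z :: nat \<Rightarrow> real \<times> real. snd (z k)) \<in> borel_measurable borel" for k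
    by (intro borel_measurable_continuous_onI continuous_intros; simp)+
  have [measurable]: "(\<lambda>z. fst (T_n t1 t2 n z)) \<in> borel_measurable borel"
    "(\<lambda>z. snd (T_n t1 t2 n z)) \<in> borel_measurable borel" for n
    unfolding T_n_eq_means by measurable
  show "T_lower t1 t2 \<in> borel_measurable borel" "T_upper t1 t2 \<in> borel_measurable borel"
    unfolding T_lower_def[abs_def] T_upper_def[abs_def] by measurable
qed

text \<open>An almost sure statement gives mass one only once the event is known to be measurable,
  since \<open>emeasure\<close> is 0 on other sets.\<close>

lemma infinite_sample_consistent_estimatorI_AE:
  assumes \<gamma>: "\<And>\<theta>. prob_space (\<gamma> \<theta>)" "\<And>\<theta>. sets (\<gamma> \<theta>) = sets borel"
    and T: "T \<in> borel_measurable borel"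
    and AE: "\<And>\<theta>. AE z in power_measure (\<gamma> \<theta>). T z = \<theta>"
  shows "infinite_sample_consistent_estimator \<gamma> T"
  unfolding infinite_sample_consistent_estimator_def
proof (intro conjI allI \<gamma> T)
  fix \<theta>
  interpret P: prob_space "power_measure (\<gamma> \<theta>)"
    unfolding power_measure_def by (intro prob_space_PiM \<gamma>)
  \<comment> \<open>Measurability of \<open>T\<close> refers to the Borel sets, the measure to the
    product sigma-algebra. The two agree for countably many copies of the plane, which is second
    countable.\<close>
  have sets: "sets (power_measure (\<gamma> \<theta>)) = sets borel"
    unfolding power_measure_def sets_PiM_equal_borel[symmetric] by (intro sets_PiM_cong \<gamma>) simp
  have "{z. T z = \<theta>} \<in> sets (power_measure (\<gamma> \<theta>))"
    using measurable_sets[OF T, of "{\<theta>}"] by (simp add: sets vimage_def)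
  then show "emeasure (power_measure (\<gamma> \<theta>)) {z. T z = \<theta>} = 1"
    using AE[of \<theta>] by (intro P.emeasure_eq_1_AE) auto
qed

theorem theorem5p2:
  fixes \<sigma> t1 t2 :: real
  assumes "\<sigma> > 0" and "t1 > 0" and "t2 > 0" and "t1 \<noteq> t2"
  shows "infinite_sample_consistent_estimator (two_time_law \<sigma> t1 t2) (T_lower t1 t2) \<and>
         infinite_sample_consistent_estimator (two_time_law \<sigma> t1 t2) (T_upper t1 t2)"
proof -
  \<comment> \<open>On the single event where \<open>T_n\<close> converges, both estimators take the
    value of the parameter.\<close>
  have "AE z in power_measure (two_time_law \<sigma> t1 t2 \<theta>).
      T_lower t1 t2 z = \<theta> \<and> T_upper t1 t2 z = \<theta>" for \<theta>
  proof (cases \<theta>)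
    case (Pair x0 \<mu>)
    show ?thesis
      using AE_T_n_tendsto[OF assms, of x0 \<mu>] unfolding Pair
      by eventually_elim (auto intro: T_limits_eq)
  qed
  then show ?thesis
    using assms
    by (intro conjI infinite_sample_consistent_estimatorI_AE prob_space_two_time_law
        sets_two_time_law T_limits_measurable) auto
qed

end
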